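(* Let $T>0$ and let $a\colon\mathbb{R}\to\mathbb{R}$ be a locally integrable $T$-periodic function such that $\int_0^T a(t)\,dt<0$ and such that there exist $m\ge1$ intervals $I_1^+,\dots,I_m^+$, closed and pairwise disjoint in the quotient space $\mathbb{R}/T\mathbb{Z}$, with $a(t)\ge0$ for a.e. $t\in I_i^+$ and $a\not\equiv0$ on $I_i^+$ for $i=1,\dots,m$, and $a(t)\le0$ for a.e. $t\in(\mathbb{R}/T\mathbb{Z})\setminus\bigcup_{i=1}^m I_i^+$. Let $g\colon[0,+\infty)\to[0,+\infty)$ be a continuously differentiable function with $g(0)=0$, $g(u)>0$ for $u>0$, and $$\limsup_{u\to+\infty}\frac{|g'(u)|}{g(u)^{\eta}}<+\infty\quad\text{for some }\eta\in[0,1).$$ Then there exists $\lambda_*>0$ such that for every $\lambda\in(0,\lambda_* )$ there are no positive $T$-periodic solutions to $$\left(\frac{u'}{\sqrt{1-(u')^2}}\right)'+\lambda a(t)g(u)=0 .$$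
   Context: Set $\varphi(\xi)=\xi/\sqrt{1-\xi^2}$ for $\xi\in(-1,1)$. A solution of $(\varphi(u'))'+\lambda a(t)g(u)=0$ is a continuously differentiable function $u$ (with $|u'|<1$) such that $t\mapsto\varphi(u'(t))$ is locally absolutely continuous and the equation holds for almost every $t$. A $T$-periodic solution is a solution defined on $\mathbb{R}$ with $u(t+T)=u(t)$ for all $t$; it is positive if $u(t)>0$ for all $t\in\mathbb{R}$. "$a\not\equiv0$ on an interval" means $a$ is not a.e. zero there. *)

theory Defs
  imports "HOL-Analysis.Analysis"
begin

definition phi :: "real \<Rightarrow> real" where
  "phi \<xi> = \<xi> / sqrt (1 - \<xi>\<^sup>2)"

definition abs_continuous_on :: "real set \<Rightarrow> (real \<Rightarrow> real) \<Rightarrow> bool" where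
  "abs_continuous_on S f \<longleftrightarrow>
     (\<forall>\<epsilon>>0. \<exists>\<delta>>0. \<forall>(n::nat) x y.
        (\<forall>i<n. x i \<le> y i \<and> {x i..y i} \<subseteq> S) \<and>
        disjoint_family_on (\<lambda>i. {x i<..<y i}) {..<n} \<and>
        (\<Sum>i<n. y i - x i) < \<delta> \<longrightarrow>
        (\<Sum>i<n. \<bar>f (y i) - f (x i)\<bar>) < \<epsilon>)"

definition locally_abs_continuous :: "(real \<Rightarrow> real) \<Rightarrow> bool" where
  "locally_abs_continuous f \<longleftrightarrow> (\<forall>\<alpha> \<beta>. abs_continuous_on {\<alpha>..\<beta>} f)"

definition locally_integrable :: "(real \<Rightarrow> real) \<Rightarrow> bool" where
  "locally_integrable f \<longleftrightarrow> (\<forall>\<alpha> \<beta>. f absolutely_integrable_on {\<alpha>..\<beta>})"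

definition periodic :: "real \<Rightarrow> (real \<Rightarrow> 'a) \<Rightarrow> bool" where
  "periodic T f \<longleftrightarrow> (\<forall>t. f (t + T) = f t)"

text \<open>The canonical projection of the line onto its quotient by the integer multiples of T;
  points of the quotient are cosets.\<close>

definition circle_proj :: "real \<Rightarrow> real \<Rightarrow> real set" where
  "circle_proj T t = range (\<lambda>k::int. t + of_int k * T)"

text \<open>Arcs that wrap around the base point are included, since the interval
  being projected need not lie in a fixed fundamental domain.\<close>

definition closed_interval_circle :: "real \<Rightarrow> real set set \<Rightarrow> bool" where
  "closed_interval_circle T J \<longleftrightarrow> (\<exists>\<alpha> \<beta>. \<alpha> \<le> \<beta> \<and> J = circle_proj T ` {\<alpha>..\<beta>})"

text \<open>A function on the closed half-line is represented by a total function whose values at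
  negative arguments are irrelevant; hence the derivative at 0 is one-sided, and
  \<^const>\<open>C1_differentiable_on\<close>, which uses two-sided derivatives, would be too strong.\<close>

definition C1_on_halfline :: "(real \<Rightarrow> real) \<Rightarrow> bool" where
  "C1_on_halfline g \<longleftrightarrow>
     (\<exists>g'. (\<forall>u\<ge>0. (g has_real_derivative g' u) (at u within {0..})) \<and> continuous_on {0..} g')"

text \<open>Solutions defined on the whole line. Their values must be nonnegative for
  \<open>g (u t)\<close> to be meaningful.\<close>

definition is_solution :: "real \<Rightarrow> (real \<Rightarrow> real) \<Rightarrow> (real \<Rightarrow> real) \<Rightarrow> (real \<Rightarrow> real) \<Rightarrow> bool" where
  "is_solution lam a g u \<longleftrightarrow>
     u C1_differentiable_on UNIV \<and>
     (\<forall>t. u t \<ge> 0) \<and>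
     (\<forall>t. \<bar>deriv u t\<bar> < 1) \<and>
     locally_abs_continuous (\<lambda>t. phi (deriv u t)) \<and>
     (AE t in lebesgue. (\<lambda>s. phi (deriv u s)) differentiable (at t) \<and>
        deriv (\<lambda>s. phi (deriv u s)) t + lam * a t * g (u t) = 0)"

definition positive_periodic_solution ::
    "real \<Rightarrow> real \<Rightarrow> (real \<Rightarrow> real) \<Rightarrow> (real \<Rightarrow> real) \<Rightarrow> (real \<Rightarrow> real) \<Rightarrow> bool" where
  "positive_periodic_solution T lam a g u \<longleftrightarrow>
     is_solution lam a g u \<and> periodic T u \<and> (\<forall>t. u t > 0)"

end

theory Submission
  imports Defs
begin

text \<open>Write \<open>A\<close> for the integral of \<open>\<bar>a\<bar>\<close> over a period. For a positive periodic solution \<open>u\<close>, dividing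
the equation by \<open>g u\<close> and integrating by parts over a period gives
\<open>\<integral> phi (u') u' g'(u) / g(u)\<^sup>2 = - lam \<integral> a\<close> (lemma \<open>averaged_identity\<close>). The right-hand side is
of order \<open>lam\<close>, because the mean of \<open>a\<close> is not zero, whereas the left-hand side is of smaller order:
the flux \<open>phi (u')\<close> contributes one factor \<open>lam\<close> (lemma \<open>flux_bound\<close>) and the slope \<open>u'\<close> a further
positive power of it.

The point is to obtain this uniformly over all solutions, whatever their size. If
\<open>\<bar>g'\<bar> \<le> C g powr \<eta>\<close> along the solution and \<open>\<gamma>\<close> is the maximum of \<open>g u\<close>, then \<open>\<bar>u'\<bar>\<close> is bounded
both by 1 and by \<open>lam A \<gamma>\<close>, hence by \<open>(lam A \<gamma>) powr (1 - \<eta>)\<close>. With this interpolated bound every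
power of \<open>\<gamma>\<close> cancels: \<open>g u\<close> is comparable to \<open>\<gamma>\<close> on the whole period, and the left-hand side above
is at most a constant times \<open>lam powr (2 - \<eta>)\<close> (lemma \<open>weight_mean_bound\<close>). As \<open>\<eta> < 1\<close>, this is
impossible for small \<open>lam\<close>.

Since \<open>\<bar>u'\<bar> < 1\<close>, a solution oscillates by at most \<open>T\<close> over a period. Hence its range either lies in
the region of large values, where the growth hypothesis applies with the given exponent, or in a
fixed bounded interval, where \<open>g'\<close> is bounded and \<open>\<eta> = 0\<close> serves.\<close>

section \<open>Absolutely continuous functions\<close>

text \<open>A division arrives as a finite set of tagged intervals, without an enumeration; hence this form of
absolute continuity, in which the intervals are indexed by an arbitrary finite set.\<close>

lemma abs_continuous_on_finite:
  assumes F: "abs_continuous_on S F" and "\<epsilon> > 0"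
  shows "\<exists>\<delta>>0. \<forall>(q::'a set) x y. finite q \<longrightarrow> (\<forall>i\<in>q. x i \<le> y i \<and> {x i..y i} \<subseteq> S) \<longrightarrow>
           disjoint_family_on (\<lambda>i. {x i<..<y i}) q \<longrightarrow> (\<Sum>i\<in>q. y i - x i) < \<delta> \<longrightarrow>
           (\<Sum>i\<in>q. \<bar>F (y i) - F (x i)\<bar>) < \<epsilon>"
proof -
  obtain \<delta> where "\<delta> > 0" and \<delta>: "\<And>(n::nat) x y.
        \<lbrakk>\<forall>i<n. x i \<le> y i \<and> {x i..y i} \<subseteq> S; disjoint_family_on (\<lambda>i. {x i<..<y i}) {..<n};
        (\<Sum>i<n. y i - x i) < \<delta>\<rbrakk> \<Longrightarrow> (\<Sum>i<n. \<bar>F (y i) - F (x i)\<bar>) < \<epsilon>"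
    using F \<open>\<epsilon> > 0\<close> unfolding abs_continuous_on_def by meson
  show ?thesis
  proof (intro exI[of _ \<delta>] conjI \<open>\<delta> > 0\<close> allI impI)
    fix q :: "'a set" and x y
    assume q: "finite q" "\<forall>i\<in>q. x i \<le> y i \<and> {x i..y i} \<subseteq> S"
      "disjoint_family_on (\<lambda>i. {x i<..<y i}) q" "(\<Sum>i\<in>q. y i - x i) < \<delta>"
    obtain h where h: "bij_betw h {..<card q} q"
      using ex_bij_betw_nat_finite[OF \<open>finite q\<close>] by (auto simp: lessThan_atLeast0)
    have "(\<Sum>i<card q. \<bar>F (y (h i)) - F (x (h i))\<bar>) < \<epsilon>"
    proof (rule \<delta>)
      show "\<forall>i<card q. x (h i) \<le> y (h i) \<and> {x (h i)..y (h i)} \<subseteq> S"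
        using q(2) bij_betwE[OF h] by blast
      show "disjoint_family_on (\<lambda>i. {x (h i)<..<y (h i)}) {..<card q}"
        using q(3) bij_betwE[OF h] bij_betw_imp_inj_on[OF h]
        unfolding disjoint_family_on_def inj_on_def by blast
      show "(\<Sum>i<card q. y (h i) - x (h i)) < \<delta>"
        using q(4) sum.reindex_bij_betw[OF h, of "\<lambda>i. y i - x i"] by simp
    qed
    then show "(\<Sum>i\<in>q. \<bar>F (y i) - F (x i)\<bar>) < \<epsilon>"
      using sum.reindex_bij_betw[OF h, of "\<lambda>i. \<bar>F (y i) - F (x i)\<bar>"] by simp
  qed
qed

text \<open>The fundamental theorem of calculus for absolutely continuous functions, read directly from the
definition of the gauge integral; the integrability of \<open>f\<close> is part of the conclusion. Where \<open>F\<close>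
has derivative \<open>f t\<close>, the gauge is chosen so that the increment of \<open>F\<close> over an interval tagged at
\<open>t\<close> is \<open>f t\<close> times its length up to a small multiple of that length. The other points form a null
set, on which \<open>f\<close> may be replaced by 0; there the gauge keeps the intervals inside an open set of
small measure, so that absolute continuity makes their increments negligible.\<close>

lemma has_integral_deriv_of_abs_continuous:
  fixes F f :: "real \<Rightarrow> real"
  assumes "a \<le> b" and F: "abs_continuous_on {a..b} F"
    and f: "AE t in lebesgue. t \<in> {a..b} \<longrightarrow> (F has_real_derivative f t) (at t within {a..b})"
  shows "(f has_integral (F b - F a)) {a..b}"
proof -
  obtain N where N: "N \<in> null_sets lebesgue"
      "{t \<in> space lebesgue. \<not> (t \<in> {a..b} \<longrightarrow> (F has_real_derivative f t) (at t within {a..b}))} \<subseteq> N"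
    using f unfolding eventually_ae_filter by blast
  have Nf: "(F has_real_derivative f t) (at t within {a..b})" if "t \<in> {a..b} - N" for t
    using N(2) that by auto
  have "negligible N" using N(1) by (simp add: negligible_iff_null_sets)
  define f0 where "f0 t = (if t \<in> N then 0 else f t)" for t
  have "(f0 has_integral (F b - F a)) {a..b}"
    unfolding has_integral_real
  proof (intro allI impI)
    fix e :: real assume "e > 0"
    \<comment> \<open>Half of the tolerance goes to the points of differentiability, half to the null set. The
      summand 1 covers the case of an interval of length zero.\<close>
    define e1 where "e1 = e / (2 * (b - a + 1))"
    have "e1 > 0" using \<open>e > 0\<close> \<open>a \<le> b\<close> by (simp add: e1_def)
    obtain \<delta> where "\<delta> > 0" and
      \<delta>: "\<And>(q::(real \<times> real set) set) x y. \<lbrakk>finite q; \<forall>i\<in>q. x i \<le> y i \<and> {x i..y i} \<subseteq> {a..b};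
           disjoint_family_on (\<lambda>i. {x i<..<y i}) q; (\<Sum>i\<in>q. y i - x i) < \<delta>\<rbrakk>
         \<Longrightarrow> (\<Sum>i\<in>q. \<bar>F (y i) - F (x i)\<bar>) < e / 2"
      using abs_continuous_on_finite[OF F half_gt_zero[OF \<open>e > 0\<close>], where ?'a = "real \<times> real set"]
      by auto
    obtain U where U: "open U" "N \<subseteq> U" "U \<in> lmeasurable" "measure lebesgue U < \<delta>"
    proof -
      obtain U where "open U" "N \<subseteq> U" "U - N \<in> lmeasurable" "emeasure lebesgue (U - N) < ennreal \<delta>"
        using sets_lebesgue_outer_open[OF negligible_imp_sets[OF \<open>negligible N\<close>] \<open>\<delta> > 0\<close>] by blast
      moreover have "U = (U - N) \<union> N" using \<open>N \<subseteq> U\<close> by blast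
      then have "U \<in> lmeasurable"
        using \<open>U - N \<in> lmeasurable\<close> negligible_imp_measurable[OF \<open>negligible N\<close>]
        by (metis fmeasurable.Un)
      moreover have "measure lebesgue U = measure lebesgue (U - N)"
        using measure_Diff_null_set[OF _ N(1), of U] \<open>U \<in> lmeasurable\<close> by (simp add: fmeasurableD)
      moreover have "measure lebesgue (U - N) < \<delta>"
        using \<open>emeasure lebesgue (U - N) < ennreal \<delta>\<close> \<open>U - N \<in> lmeasurable\<close>
        by (metis emeasure_eq_measure2 ennreal_less_iff measure_nonneg)
      ultimately show thesis using that by simp
    qed
    have "\<exists>d>0. (t \<in> N \<longrightarrow> ball t d \<subseteq> U) \<and> (t \<in> {a..b} - N \<longrightarrow>
         (\<forall>s\<in>{a..b}. \<bar>s - t\<bar> < d \<longrightarrow> \<bar>F s - F t - (s - t) * f t\<bar> \<le> e1 * \<bar>s - t\<bar>))" for t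
    proof (cases "t \<in> N")
      case True
      then show ?thesis using U(1,2) open_contains_ball by blast
    next
      case False
      show ?thesis
      proof (cases "t \<in> {a..b}")
        case True
        then have "(F has_vector_derivative f t) (at t within {a..b})"
          using Nf False by (simp add: has_real_derivative_iff_has_vector_derivative)
        then show ?thesis
          using \<open>e1 > 0\<close> False unfolding has_vector_derivative_def has_derivative_within_alt
          by auto
      qed (use False zero_less_one in blast)
    qed
    then obtain d where d0: "\<And>t. d t > 0" and dU: "\<And>t. t \<in> N \<Longrightarrow> ball t (d t) \<subseteq> U"
      and df: "\<And>t s. \<lbrakk>t \<in> {a..b} - N; s \<in> {a..b}; \<bar>s - t\<bar> < d t\<rbrakk>
                 \<Longrightarrow> \<bar>F s - F t - (s - t) * f t\<bar> \<le> e1 * \<bar>s - t\<bar>"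
      by metis
    show "\<exists>\<gamma>. gauge \<gamma> \<and> (\<forall>\<D>. \<D> tagged_division_of {a..b} \<and> \<gamma> fine \<D> \<longrightarrow>
             norm ((\<Sum>(x, k)\<in>\<D>. measure lborel k *\<^sub>R f0 x) - (F b - F a)) < e)"
    proof (intro exI conjI allI impI; (elim conjE)?)
      show "gauge (\<lambda>t. ball t (d t))" using d0 gauge_ball_dependent by blast
      fix p assume p: "p tagged_division_of {a..b}" and fine: "(\<lambda>t. ball t (d t)) fine p"
      have "finite p" using p by blast
      \<comment> \<open>Oriented from the interval to \<open>K\<close>: the converse direction would rewrite \<open>K\<close> for ever.\<close>
      have pK: "x \<in> K" "{Inf K..Sup K} = K" "Inf K \<le> Sup K" "K \<subseteq> {a..b}" "K \<subseteq> ball x (d x)"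
        if xK: "(x, K) \<in> p" for x K
      proof -
        show "x \<in> K" "K \<subseteq> {a..b}" using p xK by blast+
        show "K \<subseteq> ball x (d x)" using fine xK unfolding fine_def by blast
        obtain u v where "K = {u..v}"
          using tagged_division_ofD(4)[OF p xK] unfolding box_real by blast
        moreover from this have "u \<le> v" using \<open>x \<in> K\<close> by simp
        ultimately show "{Inf K..Sup K} = K" "Inf K \<le> Sup K" by simp_all
      qed
      have pK_mem: "Inf K \<in> K" "Sup K \<in> K" if "(x, K) \<in> p" for x K
        using pK(2)[OF that] pK(3)[OF that] by (metis atLeastAtMost_iff order_refl)+
      have pK_between: "Inf K \<le> x" "x \<le> Sup K" if "(x, K) \<in> p" for x K
        using pK(1)[OF that] pK(2)[OF that] by (metis atLeastAtMost_iff)+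
      have len: "b - a = (\<Sum>(x,K)\<in>p. Sup K - Inf K)"
        and inc: "F b - F a = (\<Sum>(x,K)\<in>p. F (Sup K) - F (Inf K))"
        using additive_tagged_division_1[OF \<open>a \<le> b\<close> p, of "\<lambda>x. x"]
          additive_tagged_division_1[OF \<open>a \<le> b\<close> p, of F] by auto
      have cont: "measure lborel K = Sup K - Inf K" if "(x, K) \<in> p" for x K
        using content_real[OF pK(3)[OF that]] pK(2)[OF that] by simp
      define err where "err = (\<lambda>(x,K). measure lborel K * f0 x - (F (Sup K) - F (Inf K)))"
      define q where "q = {z \<in> p. fst z \<in> N}"
      have "q \<subseteq> p" "finite q" using \<open>finite p\<close> by (auto simp: q_def)
      have disj: "disjoint_family_on (\<lambda>z. {Inf (snd z)<..<Sup (snd z)}) p"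
        unfolding disjoint_family_on_def
      proof (intro ballI impI)
        fix z w assume "z \<in> p" "w \<in> p" "z \<noteq> w"
        moreover obtain x K y L where zw: "z = (x, K)" "w = (y, L)" by (cases z, cases w)
        ultimately have "interior K \<inter> interior L = {}"
          using tagged_division_ofD(5)[OF p, of x K y L] by simp
        moreover have "interior K = {Inf K<..<Sup K}" "interior L = {Inf L<..<Sup L}"
          using pK(2) zw \<open>z \<in> p\<close> \<open>w \<in> p\<close> by (metis interior_atLeastAtMost_real)+
        ultimately show "{Inf (snd z)<..<Sup (snd z)} \<inter> {Inf (snd w)<..<Sup (snd w)} = {}"
          by (simp add: zw)
      qed
      have good: "(\<Sum>z\<in>p - q. \<bar>err z\<bar>) \<le> e1 * (b - a)"
      proof -
        have "\<bar>err z\<bar> \<le> e1 * (Sup (snd z) - Inf (snd z))" if "z \<in> p - q" for z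
        proof -
          obtain x K where z: "z = (x, K)" by (cases z)
          have xK: "(x, K) \<in> p" "x \<notin> N" using that by (auto simp: q_def z)
          note K = pK[OF xK(1)]
          note mem = pK_mem[OF xK(1)]
          have "x \<in> {a..b} - N" using K(1,4) xK by blast
          moreover have "\<bar>Sup K - x\<bar> < d x" "\<bar>Inf K - x\<bar> < d x"
            using subsetD[OF K(5) mem(1)] subsetD[OF K(5) mem(2)]
            by (simp_all add: dist_real_def abs_minus_commute)
          ultimately have "\<bar>F (Sup K) - F x - (Sup K - x) * f x\<bar> \<le> e1 * \<bar>Sup K - x\<bar>"
            "\<bar>F (Inf K) - F x - (Inf K - x) * f x\<bar> \<le> e1 * \<bar>Inf K - x\<bar>"
            using df subsetD[OF K(4) mem(1)] subsetD[OF K(4) mem(2)] by blast+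
          moreover note pK_between[OF xK(1)]
          moreover have "err z = (F (Inf K) - F x - (Inf K - x) * f x) - (F (Sup K) - F x - (Sup K - x) * f x)"
            unfolding err_def z f0_def using xK(2) by (simp add: cont[OF xK(1)], simp add: algebra_simps)
          ultimately show ?thesis by (simp add: z algebra_simps)
        qed
        then have "(\<Sum>z\<in>p - q. \<bar>err z\<bar>) \<le> (\<Sum>z\<in>p - q. e1 * (Sup (snd z) - Inf (snd z)))"
          by (rule sum_mono)
        also have "\<dots> \<le> (\<Sum>z\<in>p. e1 * (Sup (snd z) - Inf (snd z)))"
          using \<open>finite p\<close> pK(3) \<open>e1 > 0\<close> by (intro sum_mono2) auto
        also have "\<dots> = e1 * (b - a)"
          by (simp add: len sum_distrib_left case_prod_unfold)
        finally show ?thesis .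
      qed
      have bad: "(\<Sum>z\<in>q. \<bar>err z\<bar>) < e / 2"
      proof -
        have "(\<Sum>z\<in>q. Sup (snd z) - Inf (snd z))
            = (\<Sum>z\<in>q. measure lebesgue {Inf (snd z)<..<Sup (snd z)})"
        proof (intro sum.cong refl)
          fix z assume "z \<in> q"
          then have "(fst z, snd z) \<in> p" using \<open>q \<subseteq> p\<close> by auto
          from pK(3)[OF this] show "Sup (snd z) - Inf (snd z) = measure lebesgue {Inf (snd z)<..<Sup (snd z)}"
            by simp
        qed
        also have "\<dots> = measure lebesgue (\<Union>z\<in>q. {Inf (snd z)<..<Sup (snd z)})"
        proof (rule measure_finite_Union[symmetric])
          show "disjoint_family_on (\<lambda>z. {Inf (snd z)<..<Sup (snd z)}) q"
            using disj \<open>q \<subseteq> p\<close> by (rule disjoint_family_on_mono[rotated])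
        qed (use \<open>finite q\<close> in \<open>auto simp: emeasure_lborel_cbox_eq emeasure_lborel_box_eq box_real(1)[symmetric] simp del: box_real\<close>)
        also have "\<dots> \<le> measure lebesgue U"
        proof (rule measure_mono_fmeasurable)
          show "(\<Union>z\<in>q. {Inf (snd z)<..<Sup (snd z)}) \<subseteq> U"
          proof safe
            fix s x K assume "(x, K) \<in> q" and s: "s \<in> {Inf (snd (x, K))<..<Sup (snd (x, K))}"
            then have "(x, K) \<in> p" "x \<in> N" by (auto simp: q_def)
            moreover have "s \<in> K"
              using s pK(2)[OF \<open>(x, K) \<in> p\<close>]
                by (metis atLeastAtMost_iff greaterThanLessThan_iff less_imp_le snd_conv)
            ultimately show "s \<in> U" using pK(5) dU by blast
          qed
          show "(\<Union>z\<in>q. {Inf (snd z)<..<Sup (snd z)}) \<in> sets lebesgue"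
            using \<open>finite q\<close> by (intro sets.finite_UN) auto
        qed (rule U(3))
        finally have small: "(\<Sum>z\<in>q. Sup (snd z) - Inf (snd z)) < \<delta>" using U(4) by simp
        have "(\<Sum>z\<in>q. \<bar>F (Sup (snd z)) - F (Inf (snd z))\<bar>) < e / 2"
        proof (rule \<delta>[OF \<open>finite q\<close> _ _ small])
          show "disjoint_family_on (\<lambda>z. {Inf (snd z)<..<Sup (snd z)}) q"
            using disj \<open>q \<subseteq> p\<close> by (rule disjoint_family_on_mono[rotated])
          show "\<forall>z\<in>q. Inf (snd z) \<le> Sup (snd z) \<and> {Inf (snd z)..Sup (snd z)} \<subseteq> {a..b}"
          proof
            fix z assume "z \<in> q"
            then have "(fst z, snd z) \<in> p" using \<open>q \<subseteq> p\<close> by auto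
            from pK(2-4)[OF this] show "Inf (snd z) \<le> Sup (snd z) \<and> {Inf (snd z)..Sup (snd z)} \<subseteq> {a..b}"
              by metis
          qed
        qed
        moreover have "\<bar>err z\<bar> = \<bar>F (Sup (snd z)) - F (Inf (snd z))\<bar>" if "z \<in> q" for z
          using that by (auto simp: err_def q_def f0_def case_prod_unfold)
        ultimately show ?thesis by simp
      qed
      have "(\<Sum>(x, k)\<in>p. measure lborel k *\<^sub>R f0 x) - (F b - F a) = (\<Sum>z\<in>p. err z)"
        by (simp add: inc err_def sum_subtractf case_prod_unfold)
      then have "norm ((\<Sum>(x, k)\<in>p. measure lborel k *\<^sub>R f0 x) - (F b - F a)) \<le> (\<Sum>z\<in>p. \<bar>err z\<bar>)"
        by (simp add: sum_abs)
      also have "\<dots> = (\<Sum>z\<in>p - q. \<bar>err z\<bar>) + (\<Sum>z\<in>q. \<bar>err z\<bar>)"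
        using \<open>finite p\<close> \<open>q \<subseteq> p\<close> by (rule sum.subset_diff[rotated])
      also have "\<dots> < e1 * (b - a) + e / 2" using good bad by simp
      also have "\<dots> \<le> e"
      proof -
        have "e1 * (b - a) \<le> e1 * (b - a + 1)" using \<open>e1 > 0\<close> by simp
        also have "\<dots> = e / 2" using \<open>a \<le> b\<close> by (simp add: e1_def field_simps)
        finally show ?thesis by simp
      qed
      finally show "norm ((\<Sum>(x, k)\<in>p. measure lborel k *\<^sub>R f0 x) - (F b - F a)) < e" .
    qed
  qed
  then show ?thesis
    by (rule has_integral_spike[OF \<open>negligible N\<close>, rotated]) (auto simp: f0_def)
qed

lemma Lipschitz_imp_abs_continuous_on:
  assumes "L \<ge> 0" "\<And>x y. \<lbrakk>x \<in> S; y \<in> S\<rbrakk> \<Longrightarrow> \<bar>F y - F x\<bar> \<le> L * \<bar>y - x\<bar>"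
  shows "abs_continuous_on S F"
  unfolding abs_continuous_on_def
proof (intro allI impI)
  fix \<epsilon> :: real assume "\<epsilon> > 0"
  have "(\<Sum>i<n. \<bar>F (y i) - F (x i)\<bar>) < \<epsilon>"
    if xy: "\<forall>i<n. x i \<le> y i \<and> {x i..y i} \<subseteq> S" and s: "(\<Sum>i<n. y i - x i) < \<epsilon> / (L + 1)"
    for n :: nat and x y
  proof -
    have "(\<Sum>i<n. \<bar>F (y i) - F (x i)\<bar>) \<le> (\<Sum>i<n. L * (y i - x i))"
    proof (rule sum_mono)
      fix i assume "i \<in> {..<n}"
      then have "x i \<le> y i" "x i \<in> S" "y i \<in> S" using xy by force+
      then show "\<bar>F (y i) - F (x i)\<bar> \<le> L * (y i - x i)" using assms(2)[of "x i" "y i"] by simp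
    qed
    also have "\<dots> \<le> (L + 1) * (\<Sum>i<n. y i - x i)"
      using xy by (auto simp: sum_distrib_left intro!: sum_mono mult_right_mono)
    also have "\<dots> < \<epsilon>" using s \<open>L \<ge> 0\<close> by (simp add: field_simps)
    finally show ?thesis .
  qed
  then show "\<exists>\<delta>>0. \<forall>(n::nat) x y.
        (\<forall>i<n. x i \<le> y i \<and> {x i..y i} \<subseteq> S) \<and>
        disjoint_family_on (\<lambda>i. {x i<..<y i}) {..<n} \<and>
        (\<Sum>i<n. y i - x i) < \<delta> \<longrightarrow>
        (\<Sum>i<n. \<bar>F (y i) - F (x i)\<bar>) < \<epsilon>"
    using \<open>\<epsilon> > 0\<close> \<open>L \<ge> 0\<close> by (intro exI[of _ "\<epsilon> / (L + 1)"]) auto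
qed

lemma abs_continuous_on_mult:
  assumes F: "abs_continuous_on S F" and G: "abs_continuous_on S G"
    and B: "\<And>x. x \<in> S \<Longrightarrow> \<bar>F x\<bar> \<le> B" "\<And>x. x \<in> S \<Longrightarrow> \<bar>G x\<bar> \<le> B"
  shows "abs_continuous_on S (\<lambda>x. F x * G x)"
  unfolding abs_continuous_on_def
proof (intro allI impI)
  fix \<epsilon> :: real assume "\<epsilon> > 0"
  define B' where "B' = max B 0 + 1"
  have "B' > 0" by (simp add: B'_def)
  define \<epsilon>' where "\<epsilon>' = \<epsilon> / (2 * B')"
  have "\<epsilon>' > 0" using \<open>\<epsilon> > 0\<close> \<open>B' > 0\<close> by (simp add: \<epsilon>'_def)
  obtain \<delta>1 where "\<delta>1 > 0" and \<delta>1: "\<And>(n::nat) x y.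
        (\<forall>i<n. x i \<le> y i \<and> {x i..y i} \<subseteq> S) \<and> disjoint_family_on (\<lambda>i. {x i<..<y i}) {..<n} \<and>
        (\<Sum>i<n. y i - x i) < \<delta>1 \<longrightarrow> (\<Sum>i<n. \<bar>F (y i) - F (x i)\<bar>) < \<epsilon>'"
    using F \<open>\<epsilon>' > 0\<close> unfolding abs_continuous_on_def by meson
  obtain \<delta>2 where "\<delta>2 > 0" and \<delta>2: "\<And>(n::nat) x y.
        (\<forall>i<n. x i \<le> y i \<and> {x i..y i} \<subseteq> S) \<and> disjoint_family_on (\<lambda>i. {x i<..<y i}) {..<n} \<and>
        (\<Sum>i<n. y i - x i) < \<delta>2 \<longrightarrow> (\<Sum>i<n. \<bar>G (y i) - G (x i)\<bar>) < \<epsilon>'"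
    using G \<open>\<epsilon>' > 0\<close> unfolding abs_continuous_on_def by meson
  have "(\<Sum>i<n. \<bar>F (y i) * G (y i) - F (x i) * G (x i)\<bar>) < \<epsilon>"
    if xy: "\<forall>i<n. x i \<le> y i \<and> {x i..y i} \<subseteq> S" and dis: "disjoint_family_on (\<lambda>i. {x i<..<y i}) {..<n}"
      and s: "(\<Sum>i<n. y i - x i) < min \<delta>1 \<delta>2"
    for n :: nat and x y
  proof -
    have "(\<Sum>i<n. \<bar>F (y i) * G (y i) - F (x i) * G (x i)\<bar>)
       \<le> (\<Sum>i<n. B' * \<bar>F (y i) - F (x i)\<bar> + B' * \<bar>G (y i) - G (x i)\<bar>)"
    proof (rule sum_mono)
      fix i assume "i \<in> {..<n}"
      then have S: "x i \<in> S" "y i \<in> S" using xy by force+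
      have "F (y i) * G (y i) - F (x i) * G (x i)
          = G (y i) * (F (y i) - F (x i)) + F (x i) * (G (y i) - G (x i))"
        by (simp add: algebra_simps)
      then have "\<bar>F (y i) * G (y i) - F (x i) * G (x i)\<bar>
          \<le> \<bar>G (y i)\<bar> * \<bar>F (y i) - F (x i)\<bar> + \<bar>F (x i)\<bar> * \<bar>G (y i) - G (x i)\<bar>"
        by (metis abs_mult abs_triangle_ineq)
      also have "\<dots> \<le> B' * \<bar>F (y i) - F (x i)\<bar> + B' * \<bar>G (y i) - G (x i)\<bar>"
        using B(1)[OF S(1)] B(2)[OF S(2)] by (intro add_mono mult_right_mono) (auto simp: B'_def)
      finally show "\<bar>F (y i) * G (y i) - F (x i) * G (x i)\<bar>
          \<le> B' * \<bar>F (y i) - F (x i)\<bar> + B' * \<bar>G (y i) - G (x i)\<bar>" .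
    qed
    also have "\<dots> = B' * (\<Sum>i<n. \<bar>F (y i) - F (x i)\<bar>) + B' * (\<Sum>i<n. \<bar>G (y i) - G (x i)\<bar>)"
      by (simp add: sum.distrib sum_distrib_left)
    also have "\<dots> < B' * \<epsilon>' + B' * \<epsilon>'"
      using \<delta>1[of n x y] \<delta>2[of n x y] xy dis s \<open>B' > 0\<close> by (intro add_strict_mono mult_strict_left_mono) auto
    also have "\<dots> = \<epsilon>" using \<open>B' > 0\<close> by (simp add: \<epsilon>'_def field_simps)
    finally show ?thesis .
  qed
  then show "\<exists>\<delta>>0. \<forall>(n::nat) x y.
        (\<forall>i<n. x i \<le> y i \<and> {x i..y i} \<subseteq> S) \<and>
        disjoint_family_on (\<lambda>i. {x i<..<y i}) {..<n} \<and>
        (\<Sum>i<n. y i - x i) < \<delta> \<longrightarrow>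
        (\<Sum>i<n. \<bar>F (y i) * G (y i) - F (x i) * G (x i)\<bar>) < \<epsilon>"
    using \<open>\<delta>1 > 0\<close> \<open>\<delta>2 > 0\<close> by (intro exI[of _ "min \<delta>1 \<delta>2"]) auto
qed

lemma C1_imp_abs_continuous_on:
  fixes f :: "real \<Rightarrow> real"
  assumes f: "\<And>t. t \<in> {a..b} \<Longrightarrow> (f has_real_derivative f' t) (at t within {a..b})"
    and f': "continuous_on {a..b} f'"
  shows "abs_continuous_on {a..b} f"
proof -
  have "bounded (f' ` {a..b})"
    using f' compact_continuous_image compact_imp_bounded compact_Icc by blast
  then obtain B where "B > 0" and B: "\<And>t. t \<in> {a..b} \<Longrightarrow> \<bar>f' t\<bar> \<le> B"
    unfolding bounded_pos by (auto simp: real_norm_def)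
  show ?thesis
  proof (rule Lipschitz_imp_abs_continuous_on)
    show "\<bar>f y - f x\<bar> \<le> B * \<bar>y - x\<bar>" if "x \<in> {a..b}" "y \<in> {a..b}" for x y
      using field_differentiable_bound[OF _ f, of B y x] B that by (simp add: real_norm_def)
  qed (use \<open>B > 0\<close> in simp)
qed

section \<open>Elementary inequalities\<close>

lemma abs_le_abs_phi:
  assumes "\<bar>\<xi>\<bar> < 1"
  shows "\<bar>\<xi>\<bar> \<le> \<bar>phi \<xi>\<bar>"
proof -
  have "\<xi>\<^sup>2 < 1" using assms by (simp add: abs_square_less_1)
  then have "0 < sqrt (1 - \<xi>\<^sup>2)" "sqrt (1 - \<xi>\<^sup>2) \<le> 1" by simp_all
  then show ?thesis by (simp add: phi_def abs_divide le_divide_eq mult_left_le)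
qed

text \<open>Interpolation between the bounds \<open>y \<le> 1\<close> and \<open>y \<le> x\<close>. For \<open>y = \<bar>u'\<bar>\<close> the first is the bound on
the slope built into the operator, the second comes from a small parameter; the exponent
\<open>1 - \<eta>\<close> is the one that the growth of \<open>g\<close> calls for.\<close>

lemma le_powr_of_le_one:
  fixes x y \<theta> :: real
  assumes "y \<le> 1" "0 \<le> y" "y \<le> x" "0 \<le> \<theta>" "\<theta> \<le> 1"
  shows "y \<le> x powr \<theta>"
proof (cases "y = 0")
  case False
  then have "y = y powr 1" using assms by simp
  also have "\<dots> \<le> y powr \<theta>" using assms False by (intro powr_mono') auto
  also have "\<dots> \<le> x powr \<theta>" using assms by (intro powr_mono2) auto
  finally show ?thesis .
qed simp

section \<open>Estimates for a positive periodic solution\<close>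

lemma positive_periodic_solutionD:
  assumes "positive_periodic_solution T lam a g u"
  shows "u t > 0" "u (t + T) = u t" "\<bar>deriv u t\<bar> < 1" "deriv u (t + T) = deriv u t"
    "(u has_real_derivative deriv u t) (at t)" "continuous_on S (deriv u)"
    "abs_continuous_on {\<alpha>..\<beta>} (\<lambda>t. phi (deriv u t))"
    "AE t in lebesgue. ((\<lambda>s. phi (deriv u s)) has_real_derivative - (lam * a t * g (u t))) (at t)"
proof -
  note sol = assms[unfolded positive_periodic_solution_def is_solution_def]
  show "u t > 0" "\<bar>deriv u t\<bar> < 1" "abs_continuous_on {\<alpha>..\<beta>} (\<lambda>t. phi (deriv u t))"
    using sol by (auto simp: locally_abs_continuous_def)
  have per: "u (t + T) = u t" for t using sol by (simp add: periodic_def)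
  then show "u (t + T) = u t" .
  obtain D where D: "\<And>t. (u has_real_derivative D t) (at t)" and "continuous_on UNIV D"
    using sol unfolding C1_differentiable_on_def has_real_derivative_iff_has_vector_derivative
    by blast
  have "deriv u = D" using D DERIV_imp_deriv by blast
  then show u': "(u has_real_derivative deriv u t) (at t)" for t using D by simp
  show "continuous_on S (deriv u)"
    using \<open>deriv u = D\<close> \<open>continuous_on UNIV D\<close> continuous_on_subset by blast
  have "(u has_real_derivative deriv u (t + T)) (at t)"
    using u'[of "t + T"] per by (simp add: DERIV_shift)
  then show "deriv u (t + T) = deriv u t" by (simp add: DERIV_imp_deriv)
  have "AE t in lebesgue. (\<lambda>s. phi (deriv u s)) differentiable (at t) \<and>
        deriv (\<lambda>s. phi (deriv u s)) t + lam * a t * g (u t) = 0"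
    using sol by blast
  then show "AE t in lebesgue. ((\<lambda>s. phi (deriv u s)) has_real_derivative - (lam * a t * g (u t))) (at t)"
  proof (rule AE_mp, intro AE_I2 impI, elim conjE)
    fix t assume "(\<lambda>s. phi (deriv u s)) differentiable (at t)"
      and eq: "deriv (\<lambda>s. phi (deriv u s)) t + lam * a t * g (u t) = 0"
    then have "((\<lambda>s. phi (deriv u s)) has_real_derivative deriv (\<lambda>s. phi (deriv u s)) t) (at t)"
      by (metis DERIV_imp_deriv real_differentiable_def)
    moreover have "deriv (\<lambda>s. phi (deriv u s)) t = - (lam * a t * g (u t))" using eq by simp
    ultimately show "((\<lambda>s. phi (deriv u s)) has_real_derivative - (lam * a t * g (u t))) (at t)"
      by simp
  qed
qed

text \<open>By Rolle's theorem \<open>u'\<close> vanishes somewhere in a period, so the flux \<open>phi (u')\<close> is the integral of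
\<open>- lam * a * g u\<close> from that point on.\<close>

lemma flux_bound:
  fixes a g u :: "real \<Rightarrow> real"
  assumes sol: "positive_periodic_solution T lam a g u"
    and "T > 0" "lam > 0" and a: "a absolutely_integrable_on {0..T}"
    and \<gamma>: "\<And>t. t \<in> {0..T} \<Longrightarrow> \<bar>g (u t)\<bar> \<le> \<gamma>"
    and t: "t \<in> {0..T}"
  shows "\<bar>phi (deriv u t)\<bar> \<le> lam * integral {0..T} (\<lambda>s. \<bar>a s\<bar>) * \<gamma>"
proof -
  note D = positive_periodic_solutionD[OF sol]
  have "\<gamma> \<ge> 0" using \<gamma>[of 0] \<open>T > 0\<close> by simp
  have abs_a: "(\<lambda>s. \<bar>a s\<bar>) integrable_on {0..T}"
    using a by (simp add: absolutely_integrable_on_def real_norm_def)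
  have inc: "\<bar>phi (deriv u y) - phi (deriv u x)\<bar> \<le> lam * integral {0..T} (\<lambda>s. \<bar>a s\<bar>) * \<gamma>"
    if xy: "0 \<le> x" "x \<le> y" "y \<le> T" for x y
  proof -
    have sub: "{x..y} \<subseteq> {0..T}" using xy by auto
    have abs_a': "(\<lambda>s. \<bar>a s\<bar>) integrable_on {x..y}"
      using abs_a sub integrable_on_subinterval by blast
    have "((\<lambda>s. - (lam * a s * g (u s))) has_integral (phi (deriv u y) - phi (deriv u x))) {x..y}"
    proof (rule has_integral_deriv_of_abs_continuous[OF \<open>x \<le> y\<close> D(7)])
      show "AE t in lebesgue. t \<in> {x..y} \<longrightarrow>
         ((\<lambda>s. phi (deriv u s)) has_real_derivative - (lam * a t * g (u t))) (at t within {x..y})"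
        using D(8) by (rule AE_mp) (auto intro!: AE_I2 has_field_derivative_at_within)
    qed
    then have hi: "(\<lambda>s. - (lam * a s * g (u s))) integrable_on {x..y}"
      and eq: "phi (deriv u y) - phi (deriv u x) = integral {x..y} (\<lambda>s. - (lam * a s * g (u s)))"
      by (auto simp: has_integral_iff)
    have "norm (integral {x..y} (\<lambda>s. - (lam * a s * g (u s)))) \<le> integral {x..y} (\<lambda>s. lam * \<gamma> * \<bar>a s\<bar>)"
    proof (rule Henstock_Kurzweil_Integration.integral_norm_bound_integral[OF hi])
      show "(\<lambda>s. lam * \<gamma> * \<bar>a s\<bar>) integrable_on {x..y}" using abs_a' by (rule integrable_on_mult_right)
      fix s assume "s \<in> {x..y}"
      then have "lam * \<bar>a s\<bar> * \<bar>g (u s)\<bar> \<le> lam * \<bar>a s\<bar> * \<gamma>"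
        using \<gamma> sub \<open>lam > 0\<close> by (intro mult_left_mono) auto
      then show "norm (- (lam * a s * g (u s))) \<le> lam * \<gamma> * \<bar>a s\<bar>"
        using \<open>lam > 0\<close> by (simp add: abs_mult algebra_simps)
    qed
    also have "\<dots> = lam * \<gamma> * integral {x..y} (\<lambda>s. \<bar>a s\<bar>)" by simp
    also have "\<dots> \<le> lam * \<gamma> * integral {0..T} (\<lambda>s. \<bar>a s\<bar>)"
      using sub abs_a abs_a' \<open>\<gamma> \<ge> 0\<close> \<open>lam > 0\<close>
      by (intro mult_left_mono integral_subset_le) auto
    finally show ?thesis using eq by (simp add: algebra_simps)
  qed
  have "u 0 = u T" using D(2)[of 0] by simp
  moreover have "continuous_on {0..T} u"
    using D(5) by (meson DERIV_isCont continuous_at_imp_continuous_on)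
  ultimately obtain z where z: "0 < z" "z < T" "DERIV u z :> 0"
    using Rolle[OF \<open>T > 0\<close>] D(5) real_differentiable_def by metis
  then have "phi (deriv u z) = 0" by (simp add: DERIV_imp_deriv phi_def)
  then show ?thesis
    using inc[of z t] inc[of t z] z t by (cases "z \<le> t") auto
qed

text \<open>The product of the flux with \<open>1 / g u\<close> is absolutely continuous and takes the same value at \<open>0\<close>
and at \<open>T\<close>. Its derivative is almost everywhere \<open>- lam * a\<close>, from which \<open>g u\<close> has cancelled, minus
the integrand below. So the integral of the weight, which enters
linearly in \<open>lam\<close>, is balanced by a term that is quadratic in the slope of \<open>u\<close> for small slopes.\<close>

lemma averaged_identity:
  fixes a g g' u :: "real \<Rightarrow> real"
  assumes sol: "positive_periodic_solution T lam a g u"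
    and "T > 0" and a: "a integrable_on {0..T}"
    and pos: "\<And>x. x > 0 \<Longrightarrow> g x > 0"
    and g': "\<And>x. x > 0 \<Longrightarrow> (g has_real_derivative g' x) (at x)" "continuous_on {0<..} g'"
  shows "((\<lambda>t. phi (deriv u t) * (g' (u t) * deriv u t) / (g (u t))\<^sup>2)
            has_integral - lam * integral {0..T} a) {0..T}"
proof -
  note D = positive_periodic_solutionD[OF sol]
  define F where "F t = phi (deriv u t)" for t
  define v where "v t = inverse (g (u t))" for t
  define v' where "v' t = - (g' (u t) * deriv u t / (g (u t))\<^sup>2)" for t
  have gu: "((\<lambda>t. g (u t)) has_real_derivative g' (u t) * deriv u t) (at t)" for t
    using DERIV_chain2[OF g'(1)[OF D(1)] D(5)] .
  have v: "(v has_real_derivative v' t) (at t)" for t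
    unfolding v_def v'_def
    using DERIV_inverse_fun[OF gu[of t]] pos[OF D(1)[of t]]
    by (simp add: field_simps power2_eq_square)
  have cont_u: "continuous_on {0..T} u"
    using D(5) by (meson DERIV_isCont continuous_at_imp_continuous_on)
  have cont_gu: "continuous_on {0..T} (\<lambda>t. g (u t))"
    using gu by (meson DERIV_isCont continuous_at_imp_continuous_on)
  have cont_F: "continuous_on {0..T} F"
  proof -
    have "(deriv u t)\<^sup>2 < 1" for t using D(3)[of t] by (simp add: abs_square_less_1)
    then show ?thesis unfolding F_def phi_def
      by (intro continuous_intros D(6)) (auto simp: less_imp_neq)
  qed
  have cont_v': "continuous_on {0..T} v'"
    unfolding v'_def
  proof (intro continuous_intros cont_gu D(6))
    show "continuous_on {0..T} (\<lambda>t. g' (u t))"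
      using continuous_on_compose2[OF g'(2) cont_u] D(1) by auto
  qed (use pos D(1) in \<open>auto simp: less_imp_neq[symmetric]\<close>)
  have cont_v: "continuous_on {0..T} v"
    using v by (meson DERIV_isCont continuous_at_imp_continuous_on)
  obtain B1 B2 where B: "\<And>t. t \<in> {0..T} \<Longrightarrow> \<bar>F t\<bar> \<le> B1" "\<And>t. t \<in> {0..T} \<Longrightarrow> \<bar>v t\<bar> \<le> B2"
  proof -
    have "bounded (F ` {0..T})" "bounded (v ` {0..T})"
      using cont_F cont_v by (simp_all add: compact_continuous_image compact_imp_bounded)
    then obtain B1 B2 where "\<forall>x\<in>F ` {0..T}. norm x \<le> B1" "\<forall>x\<in>v ` {0..T}. norm x \<le> B2"
      unfolding bounded_iff by blast
    then show thesis by (intro that[of B1 B2]) (auto simp: real_norm_def)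
  qed
  have "abs_continuous_on {0..T} (\<lambda>t. F t * v t)"
  proof (rule abs_continuous_on_mult)
    show "abs_continuous_on {0..T} F" unfolding F_def by (rule D(7))
    show "abs_continuous_on {0..T} v"
      using v cont_v' by (intro C1_imp_abs_continuous_on) (auto intro: has_field_derivative_at_within)
    show "\<bar>F t\<bar> \<le> max B1 B2" "\<bar>v t\<bar> \<le> max B1 B2" if "t \<in> {0..T}" for t
      using B[OF that] by auto
  qed
  moreover have "AE t in lebesgue. t \<in> {0..T} \<longrightarrow>
      ((\<lambda>t. F t * v t) has_real_derivative - lam * a t + F t * v' t) (at t within {0..T})"
    using D(8)
  proof (rule AE_mp, intro AE_I2 impI)
    fix t assume "((\<lambda>s. phi (deriv u s)) has_real_derivative - (lam * a t * g (u t))) (at t)"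
    then have "((\<lambda>t. F t * v t) has_real_derivative F t * v' t + - (lam * a t * g (u t)) * v t) (at t)"
      unfolding F_def using DERIV_mult'[OF _ v] by blast
    moreover have "- (lam * a t * g (u t)) * v t = - lam * a t"
      using pos[OF D(1)[of t]] by (simp add: v_def)
    ultimately have "((\<lambda>t. F t * v t) has_real_derivative F t * v' t + - lam * a t) (at t)"
      by (simp only:)
    then show "((\<lambda>t. F t * v t) has_real_derivative - lam * a t + F t * v' t) (at t within {0..T})"
      by (simp add: add.commute has_field_derivative_at_within)
  qed
  ultimately have "((\<lambda>t. - lam * a t + F t * v' t) has_integral (F T * v T - F 0 * v 0)) {0..T}"
    using has_integral_deriv_of_abs_continuous[of 0 T] \<open>T > 0\<close> by simp
  moreover have "F T = F 0" "v T = v 0" using D(2)[of 0] D(4)[of 0] by (simp_all add: F_def v_def)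
  ultimately have "((\<lambda>t. - lam * a t + F t * v' t) has_integral 0) {0..T}" by simp
  then have "((\<lambda>t. - lam * a t - (- lam * a t + F t * v' t)) has_integral (- lam * integral {0..T} a - 0)) {0..T}"
    using a by (intro has_integral_diff has_integral_mult_right integrable_integral)
  then show ?thesis by (simp add: F_def v'_def algebra_simps)
qed

text \<open>Let \<open>\<gamma>\<close> be the maximum of \<open>g u\<close>. Since \<open>\<bar>u'\<bar>\<close> is at most 1 and at most the
absolute value of the flux, for which \<open>flux_bound\<close> gives \<open>lam * A * \<gamma>\<close>, it is at most
\<open>(lam * A * \<gamma>) powr (1 - \<eta>)\<close>; multiplied by the growth bound \<open>C * \<gamma> powr \<eta>\<close> for \<open>g'\<close> this gives
\<open>\<kappa> * \<gamma>\<close> as a bound for the derivative of \<open>g u\<close>. The powers of \<open>\<gamma>\<close> combine to the first power, and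
this homogeneity makes the estimate independent of the size of \<open>u\<close>: for small \<open>\<kappa>\<close> the function
\<open>g u\<close> stays above \<open>\<gamma> / 2\<close>, and in the integrand of \<open>averaged_identity\<close> all powers of \<open>\<gamma>\<close>
cancel, which leaves the bound \<open>4 * lam * A * \<kappa>\<close>.\<close>

lemma weight_mean_bound:
  fixes a g g' u :: "real \<Rightarrow> real" and \<eta> C \<kappa> A :: real
  assumes sol: "positive_periodic_solution T lam a g u"
    and "T > 0" "lam > 0" and a: "a absolutely_integrable_on {0..T}"
    and pos: "\<And>x. x > 0 \<Longrightarrow> g x > 0"
    and g': "\<And>x. x > 0 \<Longrightarrow> (g has_real_derivative g' x) (at x)" "continuous_on {0<..} g'"
    and \<eta>: "0 \<le> \<eta>" "\<eta> < 1" and "C \<ge> 0"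
    and growth: "\<And>t. t \<in> {0..T} \<Longrightarrow> \<bar>g' (u t)\<bar> \<le> C * g (u t) powr \<eta>"
  defines "A \<equiv> integral {0..T} (\<lambda>s. \<bar>a s\<bar>)"
  defines "\<kappa> \<equiv> C * (lam * A) powr (1 - \<eta>)"
  assumes small: "T * \<kappa> \<le> 1 / 2"
  shows "\<bar>integral {0..T} a\<bar> \<le> 4 * T * A * \<kappa>"
proof -
  note D = positive_periodic_solutionD[OF sol]
  have gu: "((\<lambda>t. g (u t)) has_real_derivative g' (u t) * deriv u t) (at t)" for t
    using DERIV_chain2[OF g'(1)[OF D(1)] D(5)] .
  have gpos: "g (u t) > 0" for t using pos D(1) by blast
  have abs_a: "(\<lambda>s. \<bar>a s\<bar>) integrable_on {0..T}" and "a integrable_on {0..T}"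
    using a by (simp_all add: absolutely_integrable_on_def real_norm_def)
  have "A \<ge> 0" unfolding A_def using abs_a by (intro integral_nonneg) auto
  have "\<kappa> \<ge> 0" using \<open>C \<ge> 0\<close> by (simp add: \<kappa>_def)
  have "continuous_on {0..T} (\<lambda>t. g (u t))"
    using gu by (meson DERIV_isCont continuous_at_imp_continuous_on)
  then obtain z where z: "z \<in> {0..T}" "\<And>t. t \<in> {0..T} \<Longrightarrow> g (u t) \<le> g (u z)"
    using continuous_attains_sup[of "{0..T}" "\<lambda>t. g (u t)"] \<open>T > 0\<close> by auto
  define \<gamma> where "\<gamma> = g (u z)"
  have "\<gamma> > 0" using gpos by (simp add: \<gamma>_def)
  have le\<gamma>: "g (u t) \<le> \<gamma>" if "t \<in> {0..T}" for t using z that by (simp add: \<gamma>_def)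
  have flux: "\<bar>phi (deriv u t)\<bar> \<le> lam * A * \<gamma>" if "t \<in> {0..T}" for t
    unfolding A_def
    using flux_bound[OF sol \<open>T > 0\<close> \<open>lam > 0\<close> a _ that, of \<gamma>] le\<gamma> gpos by (simp add: less_imp_le)
  have rate: "\<bar>g' (u t) * deriv u t\<bar> \<le> \<kappa> * \<gamma>" if t: "t \<in> {0..T}" for t
  proof -
    have "\<bar>deriv u t\<bar> \<le> lam * A * \<gamma>" using abs_le_abs_phi[OF D(3)[of t]] flux[OF t] by simp
    then have "\<bar>deriv u t\<bar> \<le> (lam * A * \<gamma>) powr (1 - \<eta>)"
      using D(3)[of t] \<eta> by (intro le_powr_of_le_one) auto
    also have "\<dots> = (lam * A) powr (1 - \<eta>) * \<gamma> powr (1 - \<eta>)"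
      by (rule powr_mult)
    finally have "\<bar>deriv u t\<bar> \<le> (lam * A) powr (1 - \<eta>) * \<gamma> powr (1 - \<eta>)" .
    moreover have "\<bar>g' (u t)\<bar> \<le> C * \<gamma> powr \<eta>"
      using growth[OF t] powr_mono2[OF \<eta>(1) less_imp_le[OF gpos] le\<gamma>[OF t]] \<open>C \<ge> 0\<close>
      by (meson mult_left_mono order_trans)
    ultimately have "\<bar>g' (u t) * deriv u t\<bar>
        \<le> (C * \<gamma> powr \<eta>) * ((lam * A) powr (1 - \<eta>) * \<gamma> powr (1 - \<eta>))"
      unfolding abs_mult using \<open>C \<ge> 0\<close> by (intro mult_mono) auto
    also have "\<dots> = \<kappa> * (\<gamma> powr \<eta> * \<gamma> powr (1 - \<eta>))" by (simp add: \<kappa>_def)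
    also have "\<gamma> powr \<eta> * \<gamma> powr (1 - \<eta>) = \<gamma>"
      using \<open>\<gamma> > 0\<close> by (simp add: powr_add[symmetric])
    finally show ?thesis .
  qed
  have half: "\<gamma> / 2 \<le> g (u t)" if t: "t \<in> {0..T}" for t
  proof -
    have "\<bar>g (u z) - g (u t)\<bar> \<le> (\<kappa> * \<gamma>) * \<bar>z - t\<bar>"
      using field_differentiable_bound[of "{0..T}" "\<lambda>t. g (u t)" "\<lambda>t. g' (u t) * deriv u t" "\<kappa> * \<gamma>" z t]
        gu rate t z(1) by (simp add: has_field_derivative_at_within)
    also have "\<dots> \<le> (\<kappa> * \<gamma>) * T"
      using t z(1) \<open>\<kappa> \<ge> 0\<close> \<open>\<gamma> > 0\<close> by (intro mult_left_mono) auto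
    also have "\<dots> = (T * \<kappa>) * \<gamma>" by simp
    also have "\<dots> \<le> 1 / 2 * \<gamma>" using small \<open>\<gamma> > 0\<close> by (intro mult_right_mono) auto
    finally have "g (u z) - g (u t) \<le> 1 / 2 * \<gamma>" by (rule order_trans[OF abs_ge_self])
    then show ?thesis by (simp add: \<gamma>_def)
  qed
  have "norm (- lam * integral {0..T} a) \<le> (4 * lam * A * \<kappa>) * measure lborel (cbox 0 T)"
  proof (rule has_integral_bound)
    show "((\<lambda>t. phi (deriv u t) * (g' (u t) * deriv u t) / (g (u t))\<^sup>2)
            has_integral - lam * integral {0..T} a) (cbox 0 T)"
      using averaged_identity[OF sol \<open>T > 0\<close> \<open>a integrable_on {0..T}\<close> pos g'] by simp
    show "0 \<le> 4 * lam * A * \<kappa>" using \<open>lam > 0\<close> \<open>A \<ge> 0\<close> \<open>\<kappa> \<ge> 0\<close> by simp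
    fix t assume "t \<in> cbox 0 T"
    then have t: "t \<in> {0..T}" by simp
    have "\<bar>phi (deriv u t)\<bar> * \<bar>g' (u t) * deriv u t\<bar> \<le> (lam * A * \<gamma>) * (\<kappa> * \<gamma>)"
      using flux[OF t] rate[OF t] \<open>lam > 0\<close> \<open>A \<ge> 0\<close> \<open>\<gamma> > 0\<close> by (intro mult_mono) auto
    also have "\<dots> = (4 * lam * A * \<kappa>) * (\<gamma> / 2)\<^sup>2" by (simp add: power2_eq_square)
    also have "\<dots> \<le> (4 * lam * A * \<kappa>) * (g (u t))\<^sup>2"
      using half[OF t] \<open>\<gamma> > 0\<close> \<open>lam > 0\<close> \<open>A \<ge> 0\<close> \<open>\<kappa> \<ge> 0\<close> by (intro mult_left_mono power_mono) auto
    finally show "norm (phi (deriv u t) * (g' (u t) * deriv u t) / (g (u t))\<^sup>2) \<le> 4 * lam * A * \<kappa>"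
      using gpos[of t] by (simp add: abs_mult divide_le_eq)
  qed
  then have "lam * \<bar>integral {0..T} a\<bar> \<le> lam * (4 * T * A * \<kappa>)"
    using \<open>lam > 0\<close> \<open>T > 0\<close> by (simp add: abs_mult algebra_simps)
  then show ?thesis using \<open>lam > 0\<close> by simp
qed

section \<open>Nonexistence for small parameters\<close>

theorem theorem3p2:
  fixes T :: real and a g :: "real \<Rightarrow> real" and m :: nat and I :: "nat \<Rightarrow> real set set"
  assumes "T > 0"
    and "locally_integrable a"
    and "periodic T a"
    and "(LINT t:{0..T}|lebesgue. a t) < 0"
    and "m \<ge> 1"
    and "\<forall>i\<in>{1..m}. closed_interval_circle T (I i)"
    and "disjoint_family_on I {1..m}"
    and "\<forall>i\<in>{1..m}. AE t in lebesgue. circle_proj T t \<in> I i \<longrightarrow> a t \<ge> 0"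
    and "\<forall>i\<in>{1..m}. \<not> (AE t in lebesgue. circle_proj T t \<in> I i \<longrightarrow> a t = 0)"
    and "AE t in lebesgue. circle_proj T t \<notin> (\<Union>i\<in>{1..m}. I i) \<longrightarrow> a t \<le> 0"
    and "\<forall>u\<ge>0. g u \<ge> 0"
    and "C1_on_halfline g"
    and "g 0 = 0"
    and "\<forall>u>0. g u > 0"
    and "\<exists>\<eta>::real. 0 \<le> \<eta> \<and> \<eta> < 1 \<and>
           Limsup at_top (\<lambda>u. ereal (\<bar>deriv g u\<bar> / g u powr \<eta>)) < \<infinity>"
  shows "\<exists>lam_star>0. \<forall>lam. 0 < lam \<and> lam < lam_star \<longrightarrow>
           \<not> (\<exists>u. positive_periodic_solution T lam a g u)"
proof -
  have a: "a absolutely_integrable_on {0..T}"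
    using assms(2) by (simp add: locally_integrable_def)
  define d where "d = \<bar>integral {0..T} a\<bar>"
  have "d > 0"
    using assms(4) set_lebesgue_integral_eq_integral(2)[OF a] by (simp add: d_def)
  define A where "A = integral {0..T} (\<lambda>s. \<bar>a s\<bar>)"
  have "d \<le> A"
    unfolding d_def A_def using a
      Henstock_Kurzweil_Integration.integral_norm_bound_integral[of a "{0..T}" "\<lambda>s. \<bar>a s\<bar>"]
    by (simp add: absolutely_integrable_on_def real_norm_def)
  then have "A > 0" using \<open>d > 0\<close> by simp
  have pos: "g x > 0" if "x > 0" for x using assms(14) that by blast
  obtain g' where g'_within: "\<And>x. x \<ge> 0 \<Longrightarrow> (g has_real_derivative g' x) (at x within {0..})"
    and g'_cont: "continuous_on {0..} g'"
    using assms(12) unfolding C1_on_halfline_def by blast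
  have g': "(g has_real_derivative g' x) (at x)" if "x > 0" for x
    using g'_within[of x] at_within_interior[of x "{0..}"] that by simp
  have g'_cont': "continuous_on {0<..} g'"
    using g'_cont by (rule continuous_on_subset) auto
  obtain \<eta> :: real where \<eta>: "0 \<le> \<eta>" "\<eta> < 1"
    and lims: "Limsup at_top (\<lambda>u. ereal (\<bar>deriv g u\<bar> / g u powr \<eta>)) < \<infinity>"
    using assms(15) by blast
  obtain C where "Limsup at_top (\<lambda>u. ereal (\<bar>deriv g u\<bar> / g u powr \<eta>)) < ereal C"
    using lims less_PInf_Ex_of_nat by (metis ereal_dense2)
  from Limsup_lessD[OF this] obtain R0 where
    R0: "\<And>x. x \<ge> R0 \<Longrightarrow> \<bar>deriv g x\<bar> / g x powr \<eta> < C"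
    unfolding eventually_at_top_linorder by auto
  \<comment> \<open>The lower bound 1 keeps \<open>{R..}\<close> within the positive numbers, where \<open>deriv g\<close> is the
    derivative given by the one-sided condition.\<close>
  define R where "R = max R0 1"
  define C1 where "C1 = max C 0"
  have far: "\<bar>g' x\<bar> \<le> C1 * g x powr \<eta>" if "x \<ge> R" for x
  proof -
    have "x > 0" "x \<ge> R0" using that by (auto simp: R_def)
    then have "\<bar>g' x\<bar> / g x powr \<eta> < C" "g x powr \<eta> > 0"
      using R0[of x] DERIV_imp_deriv[OF g'] pos[of x] by simp_all
    then have "\<bar>g' x\<bar> \<le> C * g x powr \<eta>" by (simp add: divide_less_eq)
    also have "\<dots> \<le> C1 * g x powr \<eta>" by (intro mult_right_mono) (auto simp: C1_def)
    finally show ?thesis .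
  qed
  \<comment> \<open>Near 0 a positive power of \<open>g\<close> need not control \<open>g'\<close>, but there \<open>g'\<close> is bounded: this is the growth
    condition with exponent 0.\<close>
  have "bounded (g' ` {0..R + T})"
    using continuous_on_subset[OF g'_cont, of "{0..R + T}"]
    by (intro compact_imp_bounded compact_continuous_image) auto
  then obtain C2 where C2: "\<And>x. x \<in> {0..R + T} \<Longrightarrow> \<bar>g' x\<bar> \<le> C2" "C2 > 0"
    by (fastforce simp: bounded_pos real_norm_def)
  have small: "eventually (\<lambda>lam. 4 * T * A * (c * (lam * A) powr (1 - e)) < d) (at_right 0)"
    if "e < 1" for c e
  proof -
    have "((\<lambda>lam. (lam * A) powr (1 - e)) \<longlongrightarrow> 0) (at_right 0)"
    proof (rule tendsto_zero_powrI)
      show "((\<lambda>lam. lam * A) \<longlongrightarrow> 0) (at_right 0)" by (auto intro!: tendsto_eq_intros)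
      show "\<forall>\<^sub>F lam in at_right 0. 0 \<le> lam * A"
        using \<open>A > 0\<close> eventually_at_right_less[of "0::real"] by (auto elim: eventually_mono)
    qed (use that in auto)
    then have "((\<lambda>lam. 4 * T * A * (c * (lam * A) powr (1 - e))) \<longlongrightarrow> 4 * T * A * (c * 0)) (at_right 0)"
      by (intro tendsto_intros)
    then show ?thesis using \<open>d > 0\<close> by (simp add: order_tendstoD(2))
  qed
  have "eventually (\<lambda>lam. 4 * T * A * (C1 * (lam * A) powr (1 - \<eta>)) < d \<and>
      4 * T * A * (C2 * (lam * A) powr (1 - 0)) < d) (at_right 0)"
    using small[OF \<eta>(2)] small[of 0] by (intro eventually_conj) auto
  then obtain lam_star where "lam_star > 0" and
    lam_star: "\<And>lam. 0 < lam \<Longrightarrow> lam < lam_star \<Longrightarrow> 4 * T * A * (C1 * (lam * A) powr (1 - \<eta>)) < d"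
      "\<And>lam. 0 < lam \<Longrightarrow> lam < lam_star \<Longrightarrow> 4 * T * A * (C2 * (lam * A) powr (1 - 0)) < d"
    unfolding eventually_at_right_field by auto
  have excluded: False
    if "positive_periodic_solution T lam a g u" "lam > 0"
      and e: "0 \<le> e" "e < 1" "c \<ge> 0" "\<And>t. t \<in> {0..T} \<Longrightarrow> \<bar>g' (u t)\<bar> \<le> c * g (u t) powr e"
      and lt: "4 * T * A * (c * (lam * A) powr (1 - e)) < d"
    for lam u c e
  proof -
    \<comment> \<open>Since \<open>d \<le> A\<close>, the condition \<open>lt\<close> also makes \<open>T * \<kappa>\<close> small enough.\<close>
    define \<kappa> where "\<kappa> = c * (lam * A) powr (1 - e)"
    have "A * (4 * (T * \<kappa>)) < A * 1"
      using lt \<open>d \<le> A\<close> by (simp add: \<kappa>_def algebra_simps)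
    then have "4 * (T * \<kappa>) < 1" using \<open>A > 0\<close> by (simp only: mult_less_cancel_left_pos)
    then have "T * (c * (lam * A) powr (1 - e)) \<le> 1 / 2" by (simp add: \<kappa>_def)
    then show False
      using weight_mean_bound[OF that(1) \<open>T > 0\<close> that(2) a pos g' g'_cont' e] lt
      unfolding A_def d_def by simp
  qed
  have "\<not> positive_periodic_solution T lam a g u" if lam: "0 < lam" "lam < lam_star" for lam u
  proof
    assume sol: "positive_periodic_solution T lam a g u"
    note D = positive_periodic_solutionD[OF sol]
    \<comment> \<open>Because \<open>\<bar>u'\<bar> < 1\<close>, the range of \<open>u\<close> lies in \<open>{R..}\<close> or in \<open>{0..R + T}\<close>, so that one of the
      two growth conditions holds along the whole solution.\<close>
    have osc: "\<bar>u t - u s\<bar> \<le> T" if "t \<in> {0..T}" "s \<in> {0..T}" for t s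
    proof -
      have "\<bar>u t - u s\<bar> \<le> 1 * \<bar>t - s\<bar>"
        using field_differentiable_bound[of UNIV u "deriv u" 1 t s] D(3,5)
        by (simp add: less_imp_le)
      also have "\<dots> \<le> T" using that by auto
      finally show ?thesis .
    qed
    show False
    proof (cases "\<forall>t\<in>{0..T}. u t \<ge> R")
      case True
      then show False
        using excluded[OF sol lam(1) \<eta>, of C1] far lam_star(1)[OF lam] by (simp add: C1_def)
    next
      case False
      then obtain s where "s \<in> {0..T}" "u s < R" by auto
      then have "u t \<in> {0..R + T}" if "t \<in> {0..T}" for t
        using osc[OF that, of s] D(1)[of t] by auto
      then have "\<bar>g' (u t)\<bar> \<le> C2 * g (u t) powr 0" if "t \<in> {0..T}" for t
        using C2(1)[of "u t"] that pos[OF D(1)[of t]] by simp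
      then show False
        using excluded[OF sol lam(1), of 0 C2] C2(2) lam_star(2)[OF lam] by simp
    qed
  qed
  then show ?thesis using \<open>lam_star > 0\<close> by blast
qed

end
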